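(* Consider the one-dimensional Saint-Venant system and the fully discrete central-upwind scheme with draining time and wet/dry reconstruction, with water height update $$\overline h_j^{\,n+1}=\overline h_j^{\,n}-\frac{\Delta t_{j+\frac12}H^{(1)}_{j+\frac12}-\Delta t_{j-\frac12}H^{(1)}_{j-\frac12}}{\Delta x}$$ and momentum update $$(\overline{hu})_j^{n+1}=(\overline{hu})_j^{n}-\frac{\Delta t_{j+\frac12}H^{(2),\mathrm a}_{j+\frac12}-\Delta t_{j-\frac12}H^{(2),\mathrm a}_{j-\frac12}}{\Delta x}-\Delta t\left(\frac{H^{(2),\mathrm g}_{j+\frac12}-H^{(2),\mathrm g}_{j-\frac12}}{\Delta x}+g\,\overline h_j^{\,n}\,\frac{B_{j+\frac12}-B_{j-\frac12}}{\Delta x}\right),$$ all quantities being as defined in the context. Assume that the numerical solution $\overline{\mathbf U}(t^n)$ (with $\overline h_j^{\,n}\ge0$ for all $j$) corresponds to the steady state which is a combination of the "lake at rest" and "dry lake" states, in the sense that, for the free surfaces $w_j$ of the cells, $w_j=\mathrm{Const}$ and $u=0$ whenever $\overline h_j^{\,n}>0$ (while $(\overline{hu})_j^{n}=0$ in the dry cells, $\overline h_j^{\,n}=0$). Then $\overline{\mathbf U}(t^{n+1})=\overline{\mathbf U}(t^n)$, i.e. $\overline w_j^{\,n+1}=\overline w_j^{\,n}$ and $(\overline{hu})_j^{n+1}=(\overline{hu})_j^{n}$ for all $j$; that is, the scheme is well-balanced.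
   Context: **System.** $h_t+(hu)_x=0$, $(hu)_t+(hu^2+\frac12 gh^2)_x=-ghB_x$, where $h$ is the water depth, $u$ the velocity, $g>0$ the gravitational constant, $B(x)$ the bottom, and $w:=h+B$ the free surface. "Lake at rest" steady state: $u=0$, $w=\mathrm{Const}$. "Dry lake" steady state: $hu=0$, $h=0$. A combination of the two: the domain is split into two nonoverlapping parts, a wet one where the solution is a lake at rest and a dry one where it is a dry lake. **Grid and bottom.** Uniform grid $x_\alpha=\alpha\Delta x$, cells $I_j=[x_{j-\frac12},x_{j+\frac12}]$, $j\in\mathbb Z$. The bottom is replaced by the continuous piecewise linear function interpolating the values $B_{j+\frac12}=\frac12(B(x_{j+\frac12}+0)+B(x_{j+\frac12}-0))$, and $B_j:=\frac12(B_{j+\frac12}+B_{j-\frac12})$. The unknowns are the cell averages $\overline{\mathbf U}_j=(\overline w_j,(\overline{hu})_j)$, and $\overline h_j:=\overline w_j-B_j$. The averaged velocity is $\overline u_j=(\overline{hu})_j/\overline h_j$ if $\overline h_j\ge\epsilon$ and $\overline u_j=0$ otherwise, where $\epsilon>0$ is a fixed small parameter ($\epsilon=10^{-9}$ in the numerical experiments). "$u=0$" in a wet cell means $(\overline{hu})_j=0$. **Free surface $w_j$ of cell $j$.** $w_j=\overline w_j$ if $\overline h_j\ge\frac12|B_{j+\frac12}-B_{j-\frac12}|$ (fully flooded), and $w_j=\min(B_{j-\frac12},B_{j+\frac12})+\sqrt{2\overline h_j|B_{j-\frac12}-B_{j+\frac12}|}$ otherwise (partially flooded; $w_j$ is then the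 horizontal water level on the wet part of the cell enclosing the volume $\Delta x\,\overline h_j$ above the linear bottom). **Uncorrected reconstruction.** For $q\in\{w,u\}$: $\tilde q^-_{j+\frac12}=\overline q_j+\frac{\Delta x}{2}(q_x)_j$, $\tilde q^+_{j-\frac12}=\overline q_j-\frac{\Delta x}{2}(q_x)_j$, with $$(q_x)_j=\mathrm{minmod}\Big(\theta\tfrac{\overline q_j-\overline q_{j-1}}{\Delta x},\tfrac{\overline q_{j+1}-\overline q_{j-1}}{2\Delta x},\theta\tfrac{\overline q_{j+1}-\overline q_j}{\Delta x}\Big),\quad \theta\in[1,2].$$ Here minmod of several numbers is their minimum if all are positive, their maximum if all are negative, and $0$ otherwise. **Wet/dry reconstruction.** The final values are $\mathbf U^\pm_{j+\frac12}=(w^\pm_{j+\frac12},h^\pm_{j+\frac12}u^\pm_{j+\frac12})$ with $h^\pm_{j+\frac12}=w^\pm_{j+\frac12}-B_{j+\frac12}$ and $u^\pm_{j+\frac12}=\tilde u^\pm_{j+\frac12}$. The values $w^+_{j-\frac12}$, $w^-_{j+\frac12}$ in cell $j$ are defined by cases. * *Case 1:* $\overline w_j\ge B_{j-\frac12}$ and $\overline w_j\ge B_{j+\frac12}$. * 1A: if $\tilde w^+_{j-\frac12}\ge B_{j-\frac12}$ and $\tilde w^-_{j+\frac12}\ge B_{j+\frac12}$, set $w^+_{j-\frac12}=\tilde w^+_{j-\frac12}$, $w^-_{j+\frac12}=\tilde w^-_{j+\frac12}$. * 1B: otherwise, if $\tilde w^-_{j+\frac12}<B_{j+\frac12}$,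 set $w^-_{j+\frac12}=B_{j+\frac12}$, $w^+_{j-\frac12}=2\overline w_j-B_{j+\frac12}$; if $\tilde w^+_{j-\frac12}<B_{j-\frac12}$, set $w^-_{j+\frac12}=2\overline w_j-B_{j-\frac12}$, $w^+_{j-\frac12}=B_{j-\frac12}$. * *Case 2:* $B_{j-\frac12}>\overline w_j>B_{j+\frac12}$. * 2A: if $\tilde w^+_{j+\frac12}>B_{j+\frac12}$ and $\tilde w^-_{j+\frac32}>B_{j+\frac32}$ (cell $j+1$ is fully flooded), set $w^-_{j+\frac12}=\tilde w^+_{j+\frac12}$, so $h^-_{j+\frac12}=\tilde w^+_{j+\frac12}-B_{j+\frac12}$; set $h^+_{j-\frac12}=\max\{0,2\overline h_j-h^-_{j+\frac12}\}$, $w^+_{j-\frac12}=h^+_{j-\frac12}+B_{j-\frac12}$. * 2B: otherwise set $w^-_{j+\frac12}=w_j$ (the free surface of cell $j$, which in Case 2 is $w_j=B_{j+\frac12}+\sqrt{2\overline h_j|B_{j-\frac12}-B_{j+\frac12}|}$), $h^-_{j+\frac12}=w_j-B_{j+\frac12}$, $h^+_{j-\frac12}=0$, $w^+_{j-\frac12}=B_{j-\frac12}$. * *Case 3:* $B_{j-\frac12}<\overline w_j<B_{j+\frac12}$: the mirror image of Case 2 (exchange the roles of the left and right edges, of cells $j+1$ and $j-1$, and of the superscripts $+$ and $-$). **Local speeds.** $$a^+_{j+\frac12}=\max\{u^+_{j+\frac12}+\sqrt{gh^+_{j+\frac12}},\,u^-_{j+\frac12}+\sqrt{gh^-_{j+\frac12}},\,0\},$$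 $$a^-_{j+\frac12}=\min\{u^+_{j+\frac12}-\sqrt{gh^+_{j+\frac12}},\,u^-_{j+\frac12}-\sqrt{gh^-_{j+\frac12}},\,0\}.$$ **Fluxes** (evaluated at time $t^n$; all $a^\pm$, $h^\pm$, $u^\pm$, $w^\pm$ below taken at $x_{j+\frac12}$): $$H^{(1)}_{j+\frac12}=\frac{a^+h^-u^--a^-h^+u^+}{a^+-a^-}+\frac{a^+a^-}{a^+-a^-}\,[w^+-w^-],$$ $$H^{(2),\mathrm a}_{j+\frac12}=\frac{a^+h^-(u^-)^2-a^-h^+(u^+)^2}{a^+-a^-},$$ $$H^{(2),\mathrm g}_{j+\frac12}=\frac{a^+\frac g2(h^-)^2-a^-\frac g2(h^+)^2}{a^+-a^-}+\frac{a^+a^-}{a^+-a^-}\,[h^+u^+-h^-u^-].$$ **Draining time.** $\Delta t>0$ is the global time step, $$\Delta t_j^{\mathrm{drain}}=\frac{\Delta x\,\overline h_j^{\,n}}{\max(0,H^{(1)}_{j+\frac12})+\max(0,-H^{(1)}_{j-\frac12})},\qquad \Delta t_{j+\frac12}=\min(\Delta t,\Delta t_i^{\mathrm{drain}}),\quad i=j+\tfrac12-\tfrac12\,\mathrm{sgn}\big(H^{(1)}_{j+\frac12}\big),$$ i.e. $i$ is the cell upwind of the interface. **Conventions.** If $a^+_{j+\frac12}=a^-_{j+\frac12}=0$ (which forces $h^\pm_{j+\frac12}=0$ and $u^\pm_{j+\frac12}=0$), all fluxes at that interface are $0$; if the denominator in $\Delta t_j^{\mathrm{drain}}$ vanishes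 then $\Delta t_j^{\mathrm{drain}}=+\infty$; if $H^{(1)}_{j+\frac12}=0$ then $\Delta t_{j+\frac12}=\Delta t$. Finally $\overline w_j^{\,n+1}=\overline h_j^{\,n+1}+B_j$.
   Formalization: Added: the water profile given by the free surfaces w_j is a stationary integral solution, i.e. depth is continuous, so no edge shared by a wet and a dry cell lies below lake level. Without it the claim fails: B=0, w=1 for j≤0, w=0 for j>0, hu=0 (dam break). *)

theory Defs
  imports "HOL-Analysis.Analysis"
begin

text \<open>
  Indexing: cells are indexed by integers \<open>j\<close>, and the interface \<open>x\<^sub>j\<^sub>+\<^sub>1\<^sub>/\<^sub>2\<close> also carries the
  index \<open>j\<close>.  So the cell \<open>I\<^sub>j\<close> has left interface \<open>j - 1\<close> and right interface \<open>j\<close>.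
\<close>

record scheme =
  grav :: real               \<comment> \<open>gravitational constant \<open>g\<close>\<close>
  dx :: real                 \<comment> \<open>mesh size\<close>
  theta :: real              \<comment> \<open>minmod parameter\<close>
  eps :: real                \<comment> \<open>desingularization threshold\<close>
  bottom :: "real \<Rightarrow> real"    \<comment> \<open>the given bottom \<open>B(x)\<close>, possibly discontinuous\<close>

record cell_state =
  wbar :: "int \<Rightarrow> real"
  hubar :: "int \<Rightarrow> real"

subsection \<open>Grid and piecewise linear bottom\<close>

definition x_edge :: "scheme \<Rightarrow> int \<Rightarrow> real" where
  "x_edge P j = (of_int j + 1/2) * dx P"

definition B_edge :: "scheme \<Rightarrow> int \<Rightarrow> real" where
  "B_edge P j = (Lim (at_right (x_edge P j)) (bottom P) + Lim (at_left (x_edge P j)) (bottom P)) / 2"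

definition B_cell :: "scheme \<Rightarrow> int \<Rightarrow> real" where
  "B_cell P j = (B_edge P j + B_edge P (j - 1)) / 2"

definition cell_index :: "scheme \<Rightarrow> real \<Rightarrow> int" where
  "cell_index P x = \<lfloor>x / dx P + 1/2\<rfloor>"

definition B_slope :: "scheme \<Rightarrow> real \<Rightarrow> real" where
  "B_slope P x = (let j = cell_index P x in (B_edge P j - B_edge P (j - 1)) / dx P)"

definition B_lin :: "scheme \<Rightarrow> real \<Rightarrow> real" where
  "B_lin P x = (let j = cell_index P x in B_edge P (j - 1) + B_slope P x * (x - x_edge P (j - 1)))"

subsection \<open>Cell quantities\<close>

definition hbar :: "scheme \<Rightarrow> cell_state \<Rightarrow> int \<Rightarrow> real" where
  "hbar P U j = wbar U j - B_cell P j"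

definition ubar :: "scheme \<Rightarrow> cell_state \<Rightarrow> int \<Rightarrow> real" where
  "ubar P U j = (if hbar P U j \<ge> eps P then hubar U j / hbar P U j else 0)"

definition free_surface :: "scheme \<Rightarrow> cell_state \<Rightarrow> int \<Rightarrow> real" where
  "free_surface P U j =
    (if hbar P U j \<ge> \<bar>B_edge P j - B_edge P (j - 1)\<bar> / 2 then wbar U j
     else min (B_edge P (j - 1)) (B_edge P j)
          + sqrt (2 * hbar P U j * \<bar>B_edge P (j - 1) - B_edge P j\<bar>))"

subsection \<open>Steady states\<close>

text \<open>
  Time-independent solutions of the Saint-Venant system in the integral form of the balance laws:
  over every interval the difference of the fluxes equals the integral of the source term.  The
  depth \<open>h\<close> may be discontinuous, in which case this form contains the jump conditions of a
  stationary discontinuity; \<open>Bx\<close> is the derivative of the bottom.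
\<close>

definition steady_state ::
  "real \<Rightarrow> (real \<Rightarrow> real) \<Rightarrow> (real \<Rightarrow> real) \<Rightarrow> (real \<Rightarrow> real) \<Rightarrow> bool" where
  "steady_state g Bx h u \<longleftrightarrow>
    (\<forall>a b. a \<le> b \<longrightarrow>
      h b * u b = h a * u a \<and>
      ((\<lambda>x. - g * h x * Bx x) has_integral
        ((h b * (u b)\<^sup>2 + g / 2 * (h b)\<^sup>2) - (h a * (u a)\<^sup>2 + g / 2 * (h a)\<^sup>2))) {a..b})"

text \<open>
  The water profile that the cell averages stand for: in cell \<open>j\<close> the water fills the region between
  the linear bottom and the horizontal level given by the free surface.  In a dry cell the free
  surface is at the lowest bottom value, so the depth is \<open>0\<close> there.
\<close>

definition depth_profile :: "scheme \<Rightarrow> cell_state \<Rightarrow> real \<Rightarrow> real" where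
  "depth_profile P U x = max 0 (free_surface P U (cell_index P x) - B_lin P x)"

definition velocity_profile :: "scheme \<Rightarrow> cell_state \<Rightarrow> real \<Rightarrow> real" where
  "velocity_profile P U x = ubar P U (cell_index P x)"

subsection \<open>Uncorrected reconstruction\<close>

definition minmod :: "real list \<Rightarrow> real" where
  "minmod zs =
    (if \<forall>z\<in>set zs. z > 0 then Min (set zs)
     else if \<forall>z\<in>set zs. z < 0 then Max (set zs)
     else 0)"

definition slope :: "scheme \<Rightarrow> (int \<Rightarrow> real) \<Rightarrow> int \<Rightarrow> real" where
  "slope P q j = minmod
    [theta P * ((q j - q (j - 1)) / dx P),
     (q (j + 1) - q (j - 1)) / (2 * dx P),
     theta P * ((q (j + 1) - q j) / dx P)]"

text \<open>
  Values of a cell at its two edges: for cell \<open>j\<close> the left one is the value with superscript \<open>+\<close> at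
  \<open>x\<^sub>j\<^sub>-\<^sub>1\<^sub>/\<^sub>2\<close> and the right one the value with superscript \<open>-\<close> at \<open>x\<^sub>j\<^sub>+\<^sub>1\<^sub>/\<^sub>2\<close>.
\<close>

definition tilde_left :: "scheme \<Rightarrow> (int \<Rightarrow> real) \<Rightarrow> int \<Rightarrow> real" where
  "tilde_left P q j = q j - dx P / 2 * slope P q j"

definition tilde_right :: "scheme \<Rightarrow> (int \<Rightarrow> real) \<Rightarrow> int \<Rightarrow> real" where
  "tilde_right P q j = q j + dx P / 2 * slope P q j"

subsection \<open>Wet/dry reconstruction\<close>

text \<open>
  The pair of the left and right surface values of cell \<open>j\<close>.  For nonnegative cell depths the
  surface average is at least the mean of the two bottom values, so the last branch is reached
  exactly when the average lies strictly between the left and the (larger) right bottom value.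
\<close>

definition w_recon :: "scheme \<Rightarrow> cell_state \<Rightarrow> int \<Rightarrow> real \<times> real" where
  "w_recon P U j =
    (let wj = wbar U j; hj = hbar P U j;
         BL = B_edge P (j - 1); BR = B_edge P j;
         tl = tilde_left P (wbar U); tr = tilde_right P (wbar U)
     in
     if wj \<ge> BL \<and> wj \<ge> BR then
       (if tl j \<ge> BL \<and> tr j \<ge> BR then (tl j, tr j)
        else if tr j < BR then (2 * wj - BR, BR)
        else (BL, 2 * wj - BL))
     else if BL > wj \<and> wj > BR then
       (if tl (j + 1) > BR \<and> tr (j + 1) > B_edge P (j + 1)
        then (max 0 (2 * hj - (tl (j + 1) - BR)) + BL, tl (j + 1))
        else (BL, free_surface P U j))
     else
       (if tr (j - 1) > BL \<and> tl (j - 1) > B_edge P (j - 2)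
        then (tr (j - 1), max 0 (2 * hj - (tr (j - 1) - BL)) + BR)
        else (free_surface P U j, BR)))"

text \<open>One-sided values at the interface with index \<open>j\<close>.\<close>

definition w_minus :: "scheme \<Rightarrow> cell_state \<Rightarrow> int \<Rightarrow> real" where
  "w_minus P U j = snd (w_recon P U j)"

definition w_plus :: "scheme \<Rightarrow> cell_state \<Rightarrow> int \<Rightarrow> real" where
  "w_plus P U j = fst (w_recon P U (j + 1))"

definition h_minus :: "scheme \<Rightarrow> cell_state \<Rightarrow> int \<Rightarrow> real" where
  "h_minus P U j = w_minus P U j - B_edge P j"

definition h_plus :: "scheme \<Rightarrow> cell_state \<Rightarrow> int \<Rightarrow> real" where
  "h_plus P U j = w_plus P U j - B_edge P j"

definition u_minus :: "scheme \<Rightarrow> cell_state \<Rightarrow> int \<Rightarrow> real" where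
  "u_minus P U j = tilde_right P (ubar P U) j"

definition u_plus :: "scheme \<Rightarrow> cell_state \<Rightarrow> int \<Rightarrow> real" where
  "u_plus P U j = tilde_left P (ubar P U) (j + 1)"

subsection \<open>Local speeds and fluxes\<close>

definition a_plus :: "scheme \<Rightarrow> cell_state \<Rightarrow> int \<Rightarrow> real" where
  "a_plus P U j = Max {u_plus P U j + sqrt (grav P * h_plus P U j),
                       u_minus P U j + sqrt (grav P * h_minus P U j), 0}"

definition a_minus :: "scheme \<Rightarrow> cell_state \<Rightarrow> int \<Rightarrow> real" where
  "a_minus P U j = Min {u_plus P U j - sqrt (grav P * h_plus P U j),
                        u_minus P U j - sqrt (grav P * h_minus P U j), 0}"

definition H1 :: "scheme \<Rightarrow> cell_state \<Rightarrow> int \<Rightarrow> real" where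
  "H1 P U j =
    (let ap = a_plus P U j; am = a_minus P U j in
     if ap = 0 \<and> am = 0 then 0 else
       (ap * h_minus P U j * u_minus P U j - am * h_plus P U j * u_plus P U j) / (ap - am)
       + ap * am / (ap - am) * (w_plus P U j - w_minus P U j))"

definition H2a :: "scheme \<Rightarrow> cell_state \<Rightarrow> int \<Rightarrow> real" where
  "H2a P U j =
    (let ap = a_plus P U j; am = a_minus P U j in
     if ap = 0 \<and> am = 0 then 0 else
       (ap * h_minus P U j * (u_minus P U j)\<^sup>2 - am * h_plus P U j * (u_plus P U j)\<^sup>2) / (ap - am))"

definition H2g :: "scheme \<Rightarrow> cell_state \<Rightarrow> int \<Rightarrow> real" where
  "H2g P U j =
    (let ap = a_plus P U j; am = a_minus P U j; g = grav P in
     if ap = 0 \<and> am = 0 then 0 else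
       (ap * (g / 2) * (h_minus P U j)\<^sup>2 - am * (g / 2) * (h_plus P U j)\<^sup>2) / (ap - am)
       + ap * am / (ap - am)
         * (h_plus P U j * u_plus P U j - h_minus P U j * u_minus P U j))"

subsection \<open>Draining time and time step\<close>

definition dt_drain :: "scheme \<Rightarrow> cell_state \<Rightarrow> int \<Rightarrow> ereal" where
  "dt_drain P U j =
    (let outflow = max 0 (H1 P U j) + max 0 (- H1 P U (j - 1)) in
     if outflow = 0 then \<infinity> else ereal (dx P * hbar P U j / outflow))"

definition dt_edge :: "scheme \<Rightarrow> real \<Rightarrow> cell_state \<Rightarrow> int \<Rightarrow> real" where
  "dt_edge P dt U j =
    (if H1 P U j = 0 then dt
     else real_of_ereal (min (ereal dt) (dt_drain P U (if H1 P U j > 0 then j else j + 1))))"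

definition h_next :: "scheme \<Rightarrow> real \<Rightarrow> cell_state \<Rightarrow> int \<Rightarrow> real" where
  "h_next P dt U j =
    hbar P U j - (dt_edge P dt U j * H1 P U j - dt_edge P dt U (j - 1) * H1 P U (j - 1)) / dx P"

definition hu_next :: "scheme \<Rightarrow> real \<Rightarrow> cell_state \<Rightarrow> int \<Rightarrow> real" where
  "hu_next P dt U j =
    hubar U j
    - (dt_edge P dt U j * H2a P U j - dt_edge P dt U (j - 1) * H2a P U (j - 1)) / dx P
    - dt * ((H2g P U j - H2g P U (j - 1)) / dx P
            + grav P * hbar P U j * ((B_edge P j - B_edge P (j - 1)) / dx P))"

definition step :: "scheme \<Rightarrow> real \<Rightarrow> cell_state \<Rightarrow> cell_state" where
  "step P dt U = \<lparr>wbar = (\<lambda>j. h_next P dt U j + B_cell P j), hubar = hu_next P dt U\<rparr>"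

end

theory Submission
  imports Defs
begin

text \<open>
  The discontinuities of a steady profile are excluded by its integral form: with zero velocity,
  \<open>g h\<^sup>2 / 2\<close> is an indefinite integral, so the depth is continuous at the interfaces.  Hence a lake
  meets a dry cell only at a point of depth \<open>0\<close>.  It then suffices that the reconstruction returns,
  at each edge of each cell, the maximum of the bottom and the free surface of that cell.  The only
  real obstruction is a nonzero minmod slope.  Since \<open>\<theta> \<le> 2\<close>, it changes the edge values by at most
  the difference to either neighbouring average, and all averages of wet cells are at least the lake
  level.  So Case 2A cannot copy a value other than the lake level, and in a fully flooded cell a
  nonzero slope, which needs a dry neighbour behind a crest at lake level, is undone by Case 1B.
\<close>

section \<open>Continuity of the steady depth at the interfaces\<close>

lemma cell_index_eq_iff:
  assumes "dx P > 0"
  shows "cell_index P x = j \<longleftrightarrow> x_edge P (j - 1) \<le> x \<and> x < x_edge P j"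
  using assms by (simp add: cell_index_def x_edge_def floor_eq_iff field_simps)

lemma x_edge_pred: "x_edge P (j - 1) = x_edge P j - dx P"
  by (simp add: x_edge_def algebra_simps)

lemma steady_state_depth_continuous:
  assumes "g > 0" and "steady_state g Bx h (\<lambda>x. 0)" and "\<And>x. h x \<ge> 0"
  shows "continuous_on {a..b} h"
proof (cases "a \<le> b")
  case True
  define f where "f = (\<lambda>x. - g * h x * Bx x)"
  have I: "(f has_integral (g / 2 * (h x)\<^sup>2 - g / 2 * (h a)\<^sup>2)) {a..x}" if "a \<le> x" for x
    using assms(2) that by (simp add: steady_state_def f_def)
  have "continuous_on {a..b} (\<lambda>x. integral {a..x} f)"
    using I[OF True] by (intro indefinite_integral_continuous_1) auto
  then have "continuous_on {a..b} (\<lambda>x. g / 2 * (h x)\<^sup>2 - g / 2 * (h a)\<^sup>2)"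
    by (rule continuous_on_eq) (use I in \<open>auto intro: integral_unique\<close>)
  \<comment> \<open>Undoing the square is continuous, and returns \<open>h\<close> itself because
    the depth is nonnegative.\<close>
  then have "continuous_on {a..b}
      (\<lambda>x. sqrt ((2 / g) * ((g / 2 * (h x)\<^sup>2 - g / 2 * (h a)\<^sup>2) + g / 2 * (h a)\<^sup>2)))"
    by (intro continuous_on_real_sqrt continuous_on_mult_left continuous_on_add continuous_on_const)
  moreover have "sqrt ((2 / g) * ((g / 2 * (h x)\<^sup>2 - g / 2 * (h a)\<^sup>2) + g / 2 * (h a)\<^sup>2)) = h x" for x
    using assms(1,3) by simp
  ultimately show ?thesis
    by (simp only:)
qed simp

text \<open>The left limit of the profile at the interface is the affine formula of cell
  \<open>j\<close> extended to its right end, whereas the value there comes from cell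
  \<open>j + 1\<close>. Continuity equates the two depths.\<close>

lemma steady_depth_at_edge:
  assumes dx: "dx P > 0"
    and cont: "continuous_on {x_edge P (j - 1)..x_edge P j} (depth_profile P U)"
  shows "max (B_edge P j) (free_surface P U j) = max (B_edge P j) (free_surface P U (j + 1))"
proof -
  define s where "s = (B_edge P j - B_edge P (j - 1)) / dx P"
  define f where "f x = max 0 (free_surface P U j - (B_edge P (j - 1) + s * (x - x_edge P (j - 1))))"
    for x
  have lt: "x_edge P (j - 1) < x_edge P j" "x_edge P j < x_edge P (j + 1)"
    using dx by (simp_all add: x_edge_def)
  have ci: "cell_index P x = j" if "x \<in> {x_edge P (j - 1)..<x_edge P j}" for x
    using that dx by (auto simp: cell_index_eq_iff)
  \<comment> \<open>Cells are half-open, so an interface belongs to the cell on its right.\<close>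
  have ci': "cell_index P (x_edge P j) = j + 1"
    using lt dx by (auto simp: cell_index_eq_iff)
  have "(depth_profile P U \<longlongrightarrow> depth_profile P U (x_edge P j)) (at_left (x_edge P j))"
    using cont lt(1) by (simp add: continuous_on_Icc_at_leftD)
  moreover have "eventually (\<lambda>x. x \<in> {x_edge P (j - 1)<..<x_edge P j}) (at_left (x_edge P j))"
    using eventually_at_left_real[OF lt(1)] .
  then have "eventually (\<lambda>x. depth_profile P U x = f x) (at_left (x_edge P j))"
    by eventually_elim (simp add: ci f_def depth_profile_def B_lin_def B_slope_def s_def Let_def)
  ultimately have "(f \<longlongrightarrow> depth_profile P U (x_edge P j)) (at_left (x_edge P j))"
    by (rule Lim_transform_eventually)
  moreover have "(f \<longlongrightarrow> f (x_edge P j)) (at_left (x_edge P j))"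
    unfolding f_def by (intro tendsto_intros)
  ultimately have "f (x_edge P j) = depth_profile P U (x_edge P j)"
    by (intro tendsto_unique[of "at_left (x_edge P j)"]) auto
  then have "max 0 (free_surface P U j - B_edge P j) = max 0 (free_surface P U (j + 1) - B_edge P j)"
    using dx x_edge_pred[of P j]
    by (simp add: f_def depth_profile_def B_lin_def ci' Let_def s_def)
  then show ?thesis
    by (simp add: max_def split: if_splits)
qed

section \<open>Bounds on the minmod increment\<close>

definition limited :: "real \<Rightarrow> real \<Rightarrow> real \<Rightarrow> real \<Rightarrow> bool" where
  "limited ql q qr s \<longleftrightarrow>
    s = 0 \<or> ql < q \<and> q < qr \<and> 0 < s \<and> s \<le> q - ql \<and> s \<le> qr - q
    \<or> ql > q \<and> q > qr \<and> 0 > s \<and> s \<ge> q - ql \<and> s \<ge> qr - q"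

lemma limited_mirror: "limited ql q qr s \<Longrightarrow> limited qr q ql (- s)"
  by (auto simp: limited_def)

text \<open>The one-sided differences bound the half-cell increment because
  \<open>theta P / 2 \<le> 1\<close>. What remains are linear inequalities, suited to the case
  analyses below.\<close>

lemma limited_slope:
  assumes dx: "dx P > 0" and th: "1 \<le> theta P" "theta P \<le> 2"
  shows "limited (q (j - 1)) (q j) (q (j + 1)) (dx P / 2 * slope P q j)"
proof -
  have th0: "theta P > 0" using th by simp
  have le: "dx P / 2 * s \<le> d" if "s \<le> theta P * (d / dx P)" "d > 0" for s d
  proof -
    have "dx P / 2 * s \<le> dx P / 2 * (theta P * (d / dx P))"
      using that dx by (intro mult_left_mono) auto
    also have "\<dots> = theta P / 2 * d" using dx by simp
    also have "\<dots> \<le> 1 * d" using that th by (intro mult_right_mono) auto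
    finally show ?thesis by simp
  qed
  have ge: "dx P / 2 * s \<ge> d" if "s \<ge> theta P * (d / dx P)" "d < 0" for s d
    using le[of "- s" "- d"] that by simp
  define a where "a = theta P * ((q j - q (j - 1)) / dx P)"
  define m where "m = (q (j + 1) - q (j - 1)) / (2 * dx P)"
  define b where "b = theta P * ((q (j + 1) - q j) / dx P)"
  have s: "slope P q j = minmod [a, m, b]"
    by (simp add: slope_def a_def b_def m_def)
  have sg: "a > 0 \<longleftrightarrow> q j > q (j - 1)" "a < 0 \<longleftrightarrow> q j < q (j - 1)"
    "b > 0 \<longleftrightarrow> q (j + 1) > q j" "b < 0 \<longleftrightarrow> q (j + 1) < q j"
    using dx th0
    by (auto simp: a_def b_def zero_less_mult_iff mult_less_0_iff zero_less_divide_iff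
        divide_less_0_iff)
  consider (pos) "a > 0" "m > 0" "b > 0" | (neg) "a < 0" "m < 0" "b < 0"
    | (zero) "\<not> (a > 0 \<and> m > 0 \<and> b > 0)" "\<not> (a < 0 \<and> m < 0 \<and> b < 0)"
    by blast
  then show ?thesis
  proof cases
    case pos
    then have "slope P q j > 0" "slope P q j \<le> a" "slope P q j \<le> b"
      by (auto simp: s minmod_def)
    then show ?thesis
      using pos sg le[of "slope P q j" "q j - q (j - 1)"] le[of "slope P q j" "q (j + 1) - q j"] dx
      by (auto simp: limited_def a_def b_def)
  next
    case neg
    then have "slope P q j < 0" "slope P q j \<ge> a" "slope P q j \<ge> b"
      by (auto simp: s minmod_def)
    then show ?thesis
      using neg sg ge[of "q j - q (j - 1)" "slope P q j"] ge[of "q (j + 1) - q j" "slope P q j"] dx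
      by (auto simp: limited_def a_def b_def mult_pos_neg)
  next
    case zero
    then show ?thesis
      by (auto simp: s minmod_def limited_def)
  qed
qed

section \<open>Edge values of a cell next to its neighbours\<close>

text \<open>
  A cell with edge bottoms \<open>b\<close>, \<open>b'\<close>, surface average \<open>w\<close> and free surface \<open>l\<close> is dry, fully flooded
  or partially flooded by a lake of level \<open>c\<close>.  The bounds on \<open>w\<close> in the last case are what is left
  of \<open>w\<close> being the mean of \<open>max c B\<close> over the cell.
\<close>

definition lake_cell :: "real \<Rightarrow> real \<Rightarrow> real \<Rightarrow> real \<Rightarrow> real \<Rightarrow> bool" where
  "lake_cell c b b' w l \<longleftrightarrow>
    2 * w = b + b' \<and> l = min b b'
    \<or> w = c \<and> l = c \<and> b \<le> c \<and> b' \<le> c \<and> b + b' < 2 * c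
    \<or> l = c \<and> min b b' < c \<and> c < w \<and> 2 * w < c + max b b'"

lemma lake_cell_mirror: "lake_cell c b b' w l \<Longrightarrow> lake_cell c b' b w l"
  by (auto simp: lake_cell_def min.commute max.commute add.commute)

text \<open>Take \<open>s > 0\<close>; the other sign is symmetric. A dry cell here is flat, so
  \<open>b1 = w2\<close>. In a wet one \<open>w2 = c\<close>, so \<open>w1 < c\<close> makes the
  left cell dry and the matching at \<open>b1\<close> again gives \<open>b1 = w2\<close>. Then
  \<open>w2 - s\<close> is below the bottom and Case 1B restores \<open>w2\<close> at both
  edges.\<close>

lemma flooded_cell_reconstruction:
  assumes "lake_cell c b0 b1 w1 l1" "lake_cell c b1 b2 w2 l2" "lake_cell c b2 b3 w3 l3"
    and "max b1 l1 = max b1 l2" "max b2 l2 = max b2 l3"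
    and "limited w1 w2 w3 s" and "b1 \<le> w2" "b2 \<le> w2"
  shows "(if w2 - s \<ge> b1 \<and> w2 + s \<ge> b2 then (w2 - s, w2 + s)
          else if w2 + s < b2 then (2 * w2 - b2, b2) else (b1, 2 * w2 - b1))
        = (max b1 l2, max b2 l2)"
  using assms unfolding lake_cell_def limited_def min_def max_def
  by (elim disjE conjE) (auto split: if_splits)

text \<open>Adding the last two hypotheses gives \<open>2 * w2 > b1 + b2\<close>, so the second cell
  is wet. If it is partially flooded, lifting its dry edge above the bottom takes an increment
  larger than \<open>max b1 b2 - w2\<close>, hence larger than \<open>w2 - c\<close>; the limiter
  forbids this, since the neighbour at the wet edge has average at least \<open>c\<close>. If it is
  flooded, \<open>s < 0\<close> would need a dry third cell with \<open>b2 = c\<close>, against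
  \<open>w2 + s > b2\<close>, and \<open>s > 0\<close> would need \<open>w1 < c\<close>.\<close>

lemma case_2A_imp_level:
  assumes "lake_cell c b0 b1 w1 l1" "lake_cell c b1 b2 w2 l2" "lake_cell c b2 b3 w3 l3"
    and "max b1 l1 = max b1 l2" "max b2 l2 = max b2 l3"
    and "limited w1 w2 w3 s" and "b0 > w1" "w1 > b1" and "w2 - s > b1" "w2 + s > b2"
  shows "w2 - s = l1"
  using assms unfolding lake_cell_def limited_def min_def max_def
  by (elim disjE conjE) (auto split: if_splits)

text \<open>The two branches agree: Case 2A yields the level \<open>l1\<close>, and
  \<open>2 * h \<le> l1 - b1\<close> makes the \<open>max\<close> vanish at the upper edge.\<close>

lemma partially_flooded_reconstruction:
  assumes "lake_cell c b0 b1 w1 l1" "lake_cell c b1 b2 w2 l2" "lake_cell c b2 b3 w3 l3"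
    and "max b1 l1 = max b1 l2" "max b2 l2 = max b2 l3"
    and "limited w1 w2 w3 s" and "b0 > w1" "w1 > b1" and h: "h = w1 - (b0 + b1) / 2"
  shows "(if w2 - s > b1 \<and> w2 + s > b2
          then (max 0 (2 * h - (w2 - s - b1)) + b0, w2 - s) else (b0, l1))
        = (max b0 l1, max b1 l1)"
proof -
  have "l1 \<le> b0" "b1 \<le> l1" "2 * w1 \<le> b0 + l1"
    using assms(1,7,8) by (auto simp: lake_cell_def min_def max_def split: if_splits)
  moreover have "2 * h - (l1 - b1) \<le> 0"
    using \<open>2 * w1 \<le> b0 + l1\<close> by (simp add: h field_simps)
  ultimately show ?thesis
    using case_2A_imp_level[OF assms(1-8)] by auto
qed

lemma lake_cell_state:
  assumes "hbar P U j \<ge> 0" and "hbar P U j > 0 \<Longrightarrow> free_surface P U j = c"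
  shows "lake_cell c (B_edge P (j - 1)) (B_edge P j) (wbar U j) (free_surface P U j)"
proof -
  define b b' h where "b = B_edge P (j - 1)" and "b' = B_edge P j" and "h = hbar P U j"
  have w: "wbar U j = (b + b') / 2 + h"
    by (simp add: h_def hbar_def B_cell_def b_def b'_def)
  have fs: "free_surface P U j =
      (if h \<ge> \<bar>b' - b\<bar> / 2 then wbar U j else min b b' + sqrt (2 * h * \<bar>b - b'\<bar>))"
    by (simp add: free_surface_def b_def b'_def h_def)
  consider "h = 0" | "h > 0" "h \<ge> \<bar>b' - b\<bar> / 2" | "h > 0" "h < \<bar>b' - b\<bar> / 2"
    using assms(1) unfolding h_def by linarith
  then have "lake_cell c b b' (wbar U j) (free_surface P U j)"
  proof cases
    case 1
    then show ?thesis by (auto simp: lake_cell_def fs w min_def)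
  next
    case 2
    then have "free_surface P U j = c" "wbar U j = c" using assms(2) fs by (simp_all add: h_def)
    moreover have "b \<le> c" "b' \<le> c" "b + b' < 2 * c"
      using 2 w \<open>wbar U j = c\<close> by argo+
    ultimately show ?thesis by (simp add: lake_cell_def)
  next
    case 3
    define d where "d = \<bar>b - b'\<bar>"
    have d: "2 * h < d" "d > 0" using 3 by (auto simp: d_def)
    define r where "r = sqrt (2 * h * d)"
    have "r > 0" using 3 d by (simp add: r_def)
    \<comment> \<open>This gives the upper bound on the average in \<open>lake_cell\<close>; the
      next inequality, a strict AM-GM, gives \<open>c < w\<close>.\<close>
    have "2 * h < r"
      unfolding r_def using 3 d by (intro real_less_rsqrt) (simp add: power2_eq_square)
    moreover have "r < d / 2 + h"
    proof -
      have "(d / 2 - h)\<^sup>2 > 0" using d by simp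
      then have "2 * h * d < (d / 2 + h)\<^sup>2" by (simp add: power2_eq_square algebra_simps)
      then show ?thesis unfolding r_def using 3 d by (intro real_less_lsqrt) auto
    qed
    moreover have "c = min b b' + r"
      using 3 assms(2) fs by (simp add: h_def[symmetric] r_def d_def)
    moreover have "free_surface P U j = c" using 3 assms(2) by (simp add: h_def)
    moreover have "max b b' = min b b' + d" "b + b' = 2 * min b b' + d"
      by (auto simp: d_def min_def max_def)
    ultimately show ?thesis
      using \<open>r > 0\<close> unfolding lake_cell_def w by argo
  qed
  then show ?thesis by (simp add: b_def b'_def)
qed

text \<open>Hydrostatic balance: up to the factor \<open>g / 2\<close>, the pressure difference
  equals the bottom force. In a flooded cell this is a difference of squares with mean depth
  \<open>hbar\<close>; in a partially flooded one a single edge is wet, and the square root in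
  \<open>free_surface\<close> supplies its squared depth.\<close>

lemma horizontal_level_balance:
  assumes "hbar P U j \<ge> 0"
  defines "l \<equiv> free_surface P U j" and "b \<equiv> B_edge P (j - 1)" and "b' \<equiv> B_edge P j"
  shows "(max b' l - b')\<^sup>2 - (max b l - b)\<^sup>2 = - 2 * hbar P U j * (b' - b)"
proof (cases "hbar P U j \<ge> \<bar>b' - b\<bar> / 2")
  case True
  then have l: "l = (b + b') / 2 + hbar P U j"
    by (simp add: l_def free_surface_def b_def b'_def hbar_def B_cell_def)
  have "b \<le> l" "b' \<le> l"
    using True l by argo+
  then have "max b l = l" "max b' l = l"
    by simp_all
  then show ?thesis
    by (simp add: l power2_eq_square field_simps)
next
  case False
  define r where "r = sqrt (2 * hbar P U j * \<bar>b - b'\<bar>)"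
  have l: "l = min b b' + r"
    using False by (simp add: l_def free_surface_def b_def b'_def r_def)
  have r2: "r\<^sup>2 = 2 * hbar P U j * \<bar>b - b'\<bar>" and r0: "r \<ge> 0"
    using assms(1) by (simp_all add: r_def)
  have "2 * hbar P U j * \<bar>b - b'\<bar> \<le> \<bar>b - b'\<bar> * \<bar>b - b'\<bar>"
    using False by (intro mult_right_mono) auto
  then have rd: "r \<le> \<bar>b - b'\<bar>"
    unfolding r_def by (intro real_le_lsqrt) (auto simp: power2_eq_square)
  show ?thesis
  proof (cases "b \<le> b'")
    case True
    then have "max b l = b + r" "max b' l = b'"
      using l r0 rd by auto
    then show ?thesis using True r2 by simp
  next
    case False
    then have "max b l = b" "max b' l = b' + r"
      using l r0 rd by auto
    then show ?thesis using False r2 by (simp add: algebra_simps)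
  qed
qed

section \<open>Reconstruction and fluxes of the steady state\<close>

lemma w_recon_steady:
  assumes "dx P > 0" and "1 \<le> theta P" "theta P \<le> 2"
    and depth: "\<And>j. hbar P U j \<ge> 0"
    and level: "\<And>j. hbar P U j > 0 \<Longrightarrow> free_surface P U j = c"
    and match: "\<And>j. max (B_edge P j) (free_surface P U j) = max (B_edge P j) (free_surface P U (j + 1))"
  shows "w_recon P U j = (max (B_edge P (j - 1)) (free_surface P U j), max (B_edge P j) (free_surface P U j))"
proof -
  have lim: "limited (wbar U (i - 1)) (wbar U i) (wbar U (i + 1)) (dx P / 2 * slope P (wbar U) i)" for i
    using assms(1-3) by (rule limited_slope)
  have cell: "lake_cell c (B_edge P (i - 1)) (B_edge P i) (wbar U i) (free_surface P U i)" for i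
    using depth level by (intro lake_cell_state)
  have idx: "j + 1 - 1 = j" "j - 1 + 1 = j" "j - 1 - 1 = j - 2" "j - 2 + 1 = j - 1" "j - 2 - 1 = j - 3"
    "j + 1 + 1 = j + 2" "j + 2 - 1 = j + 1"
    by simp_all
  have match': "max (B_edge P (j - 1)) (free_surface P U (j - 1)) = max (B_edge P (j - 1)) (free_surface P U j)"
    "max (B_edge P (j - 2)) (free_surface P U (j - 2)) = max (B_edge P (j - 2)) (free_surface P U (j - 1))"
    using match[of "j - 1"] match[of "j - 2"] by (simp_all add: idx)
  have mean: "hbar P U j = wbar U j - (B_edge P (j - 1) + B_edge P j) / 2"
    by (simp add: hbar_def B_cell_def)
  consider (flooded) "B_edge P (j - 1) \<le> wbar U j" "B_edge P j \<le> wbar U j"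
    | (down) "B_edge P (j - 1) > wbar U j" "wbar U j > B_edge P j"
    | (up) "B_edge P (j - 1) < wbar U j" "wbar U j < B_edge P j"
    using depth[of j] mean by argo
  then show ?thesis
  proof cases
    case flooded
    then show ?thesis
      using flooded_cell_reconstruction[OF cell[of "j - 1"] cell[of j] cell[of "j + 1", unfolded idx]
          match'(1) match[of j] lim[of j] flooded] flooded
      by (simp add: w_recon_def tilde_left_def tilde_right_def Let_def split: if_splits)
  next
    case down
    then show ?thesis
      using partially_flooded_reconstruction[OF cell[of j] cell[of "j + 1", unfolded idx]
          cell[of "j + 2", unfolded idx] match[of j] match[of "j + 1", unfolded idx]
          lim[of "j + 1", unfolded idx] down mean] down
      by (auto simp: w_recon_def tilde_left_def tilde_right_def Let_def split: if_splits)
  next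
    case up
    \<comment> \<open>Case 3 is Case 2 reflected: edges and neighbours swap and the increment
      changes sign.\<close>
    have mean': "hbar P U j = wbar U j - (B_edge P j + B_edge P (j - 1)) / 2"
      using mean by (simp add: add.commute)
    show ?thesis
      using partially_flooded_reconstruction[OF cell[of j, THEN lake_cell_mirror]
          cell[of "j - 1", unfolded idx, THEN lake_cell_mirror]
          cell[of "j - 2", unfolded idx, THEN lake_cell_mirror]
          match'(1)[symmetric] match'(2)[symmetric]
          lim[of "j - 1", unfolded idx, THEN limited_mirror] up(2,1) mean'] up
      by (auto simp: w_recon_def tilde_left_def tilde_right_def Let_def split: if_splits)
  qed
qed

text \<open>Equal depths at rest give opposite speeds, so \<open>H2g\<close> averages two equal
  pressures; at \<open>h = 0\<close> the zero-flux convention applies.\<close>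

lemma fluxes_at_rest:
  assumes "grav P > 0" and "u_minus P U j = 0" "u_plus P U j = 0"
    and "h_minus P U j = h" "h_plus P U j = h" and "h \<ge> 0"
  shows "H1 P U j = 0" "H2a P U j = 0" "H2g P U j = grav P / 2 * h\<^sup>2"
proof -
  have a: "a_plus P U j = sqrt (grav P * h)" "a_minus P U j = - sqrt (grav P * h)"
    using assms by (simp_all add: a_plus_def a_minus_def)
  have "w_plus P U j = w_minus P U j"
    using assms(4,5) by (simp add: h_minus_def h_plus_def)
  then show "H1 P U j = 0" "H2a P U j = 0"
    using assms by (simp_all add: H1_def H2a_def Let_def a)
  show "H2g P U j = grav P / 2 * h\<^sup>2"
  proof (cases "h = 0")
    case True
    then show ?thesis using assms by (simp add: H2g_def Let_def a)
  next
    case False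
    then have "sqrt (grav P * h) \<noteq> 0" using assms by simp
    then show ?thesis using assms by (simp add: H2g_def Let_def a field_simps)
  qed
qed

theorem theorem4p2:
  fixes P :: scheme and U :: cell_state and dt c :: real
  assumes "grav P > 0" and "dx P > 0" and "1 \<le> theta P" and "theta P \<le> 2" and "eps P > 0"
    and "dt > 0"
    and bottom_limits: "\<And>j. (\<exists>l. (bottom P \<longlongrightarrow> l) (at_left (x_edge P j))) \<and>
                            (\<exists>l. (bottom P \<longlongrightarrow> l) (at_right (x_edge P j)))"
    and depth_nonneg: "\<And>j. hbar P U j \<ge> 0"
    and wet: "\<And>j. hbar P U j > 0 \<Longrightarrow> free_surface P U j = c \<and> hubar U j = 0"
    and dry: "\<And>j. hbar P U j = 0 \<Longrightarrow> hubar U j = 0"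
    and steady: "steady_state (grav P) (B_slope P) (depth_profile P U) (velocity_profile P U)"
  shows "\<forall>j. wbar (step P dt U) j = wbar U j \<and> hubar (step P dt U) j = hubar U j"
proof
  fix j
  have hu: "hubar U i = 0" for i
    using depth_nonneg[of i] wet[of i] dry[of i] by argo
  then have ub: "ubar P U i = 0" for i
    by (simp add: ubar_def)
  then have u: "u_minus P U i = 0" "u_plus P U i = 0" for i
    by (simp_all add: u_minus_def u_plus_def tilde_left_def tilde_right_def slope_def minmod_def)
  have "velocity_profile P U = (\<lambda>x. 0)"
    by (simp add: velocity_profile_def ub fun_eq_iff)
  then have "continuous_on {a..b} (depth_profile P U)" for a b
    using steady
    by (intro steady_state_depth_continuous[OF \<open>grav P > 0\<close>]) (auto simp: depth_profile_def[abs_def])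
  then have match: "max (B_edge P i) (free_surface P U i) = max (B_edge P i) (free_surface P U (i + 1))" for i
    using assms(2) by (intro steady_depth_at_edge)
  define h where "h i = max (B_edge P i) (free_surface P U i) - B_edge P i" for i
  have recon: "w_recon P U i
      = (max (B_edge P (i - 1)) (free_surface P U i), max (B_edge P i) (free_surface P U i))" for i
    using assms(2-4) depth_nonneg wet match by (intro w_recon_steady) auto
  have hh: "h_minus P U i = h i" "h_plus P U i = h i" for i
    by (simp_all add: h_minus_def h_plus_def w_minus_def w_plus_def recon h_def match)
  have h0: "h i \<ge> 0" for i
    by (simp add: h_def)
  note flux = fluxes_at_rest[OF \<open>grav P > 0\<close> u hh h0]
  \<comment> \<open>At the left edge \<open>h\<close> is defined by the level of cell
    \<open>j - 1\<close>, and the balance by that of cell \<open>j\<close>; \<open>match\<close>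
    identifies them.\<close>
  have "(h j)\<^sup>2 - (h (j - 1))\<^sup>2 = - 2 * hbar P U j * (B_edge P j - B_edge P (j - 1))"
    using horizontal_level_balance[OF depth_nonneg, of j] match[of "j - 1"] by (simp add: h_def)
  then have "H2g P U j - H2g P U (j - 1) + grav P * hbar P U j * (B_edge P j - B_edge P (j - 1)) = 0"
    unfolding flux by algebra
  then have "(H2g P U j - H2g P U (j - 1)) / dx P
      + grav P * hbar P U j * ((B_edge P j - B_edge P (j - 1)) / dx P) = 0"
    by (metis add_divide_distrib div_0 times_divide_eq_right)
  \<comment> \<open>All terms carrying \<open>dt_edge\<close> contain \<open>H1\<close> or
    \<open>H2a\<close> and vanish; the bracket just shown to be zero is the rest of the momentum
    increment.\<close>
  then show "wbar (step P dt U) j = wbar U j \<and> hubar (step P dt U) j = hubar U j"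
    by (simp add: step_def h_next_def hu_next_def flux hbar_def)
qed

end
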